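(* Let $X_1$ and $X_2$ be subshifts (over possibly different alphabets) and, for $i=1,2$, let $E_i$ be the graph associated with $X_i$. If $E_1$ satisfies Condition (Y) and $E_2$ does not, then the Ott-Tomforde-Willis (OTW) subshifts associated with $X_1$ and $X_2$ are not conjugate.
   Context: Notation: $\mathbb N=\{0,1,2,\dots\}$. Let $\mathfrak A$ be a nonempty set (the alphabet) and let $\mathfrak A^*$ be the set of finite words over $\mathfrak A$, including the empty word $\omega$. For a nonempty word $\beta$, $\beta^\infty=\beta\beta\beta\cdots\in\mathfrak A^{\mathbb N}$. The shift is $\sigma((x_n)_{n\in\mathbb N})=(x_{n+1})_{n\in\mathbb N}$. A subshift over $\mathfrak A$ is a set $X\subseteq\mathfrak A^{\mathbb N}$ of the form $X=X_F$ for some $F\subseteq\mathfrak A^*$, where $X_F$ is the set of all sequences in which no word of $F$ occurs as a block; then $\sigma(X)\subseteq X$ and $\sigma$ is regarded as a map $X\to X$. The language $\mathcal L_X$ is the set of all finite words (including $\omega$) occurring in some element of $X$. For $\alpha,\beta\in\mathcal L_X$ put $C(\alpha,\beta)=\{\beta x\in X:\alpha x\in X\}$. Let $\mathcal U$ be the Boolean algebra of subsets of $X$ generated by all $C(\alpha,\beta)$, $\alpha,\beta\in\mathcal L_X$ (closed under finite unions, finite intersections and complements in $X$). $\mathcal Q_X$ denotes the set of all one-point sets $\{p\}\in\mathcal U$ such that $p\neq\alpha\beta^\infty$ for all $\alpha,\beta\in\mathcal L_X$ with $\beta\ne\omega$; such a set is identified with its element. For $x,y\in X$ write $x\sim y$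 if $\sigma^m(x)=\sigma^n(y)$ for some $m,n\in\mathbb N$. The graph $E$ associated with $X$: for $\{p\}\in\mathcal Q_X$ let $J_0=\{\sigma^n(p):n\in\mathbb N\}$, $J_n=\sigma^{-1}(J_{n-1})\setminus(J_0\cup\dots\cup J_{n-1})$ for $n\ge1$, and $J=\bigcup_{n\ge0}J_n$. The directed graph $E_p$ has one vertex $v_z$ and one edge $e_z$ for each $z\in J$, with source $s(e_z)=v_z$ and range $r(e_z)=v_{\sigma(z)}$. The graph $E$ is the disjoint union of the graphs $E_p$, taken over one representative $p$ of each class in $\mathcal Q_X/{\sim}$. Condition (Y): for each infinite path $e_1e_2e_3\cdots$ in the graph (meaning $r(e_i)=s(e_{i+1})$ for all $i\geq 1$) there exist $k\in\mathbb N$ and a finite path $\alpha$ with $r(\alpha)=s(e_{k+1})$ and $|\alpha|=k+1$, where $|\alpha|$ is the number of edges of $\alpha$. OTW-subshifts: the OTW-subshift associated with $X$ is $X^{OTW}=X\cup X^{fin}$, where $X^{fin}$ is the set of $\alpha\in\mathfrak A^*$ for which there are infinitely many $a\in\mathfrak A$ such that $\alpha a y\in X$ for some $y\in\mathfrak A^{\mathbb N}$. (If $\mathfrak A$ is finite, $X^{OTW}=X$.) Its topology has as basis the sets $\{y\in X^{OTW}: y \text{ begins with } \alpha \text{ and, if } |y|>|\alpha|, \text{ the letter of } y \text{ following } \alpha \text{ is not in } G\}$, for $\alpha\in\mathfrak A^*$ and finite $G\subseteq\mathfrak A$. The shift on $X^{OTW}$ deletes the first letter of a nonempty (finite or infinite)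 word and fixes $\omega$. Two OTW-subshifts are conjugate if there is a homeomorphism between them that commutes with the shifts and preserves the length (in $\mathbb N\cup\{\infty\}$) of words. *)

theory Defs
  imports
    "HOL-Analysis.Analysis"
    "HOL-Library.Omega_Words_Fun"
    "HOL-Library.Extended_Nat"
    "Graph_Theory.Arc_Walk"
begin

section \<open>Subshifts\<close>

text \<open>
  The alphabet is the type \<open>'a\<close>, finite words are lists, and one-sided sequences are
  \<open>\<omega>\<close>-words \<open>nat \<Rightarrow> 'a\<close>.  The shift on sequences is \<^term>\<open>suffix 1\<close>.
\<close>

abbreviation shift :: "'a word \<Rightarrow> 'a word" where
  "shift \<equiv> suffix 1"

definition occurs_in :: "'a list \<Rightarrow> 'a word \<Rightarrow> bool" where
  "occurs_in w x \<longleftrightarrow> (\<exists>n. x [n \<rightarrow> n + length w] = w)"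

definition avoiding :: "'a list set \<Rightarrow> 'a word set" where
  "avoiding F = {x. \<forall>w\<in>F. \<not> occurs_in w x}"

definition subshift :: "'a word set \<Rightarrow> bool" where
  "subshift X \<longleftrightarrow> (\<exists>F. X = avoiding F)"

definition language :: "'a word set \<Rightarrow> 'a list set" where
  "language X = {w. \<exists>x\<in>X. occurs_in w x}"

definition cyl :: "'a word set \<Rightarrow> 'a list \<Rightarrow> 'a list \<Rightarrow> 'a word set" where
  "cyl X \<alpha> \<beta> = {\<beta> \<frown> x | x. \<beta> \<frown> x \<in> X \<and> \<alpha> \<frown> x \<in> X}"

definition boolean_alg :: "'a word set \<Rightarrow> 'a word set set" where
  "boolean_alg X = algebra X hull {cyl X \<alpha> \<beta> | \<alpha> \<beta>. \<alpha> \<in> language X \<and> \<beta> \<in> language X}"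

text \<open>A singleton \<open>{p}\<close> of the Boolean algebra is represented by its element \<open>p\<close>.\<close>

definition Q_set :: "'a word set \<Rightarrow> 'a word set" where
  "Q_set X = {p. {p} \<in> boolean_alg X \<and>
     \<not> (\<exists>\<alpha>\<in>language X. \<exists>\<beta>\<in>language X. \<beta> \<noteq> [] \<and> p = \<alpha> \<frown> \<beta>\<^sup>\<omega>)}"

definition tail_equiv :: "'a word \<Rightarrow> 'a word \<Rightarrow> bool" where
  "tail_equiv x y \<longleftrightarrow> (\<exists>m n. suffix m x = suffix n y)"

definition Q_rel :: "'a word set \<Rightarrow> 'a word rel" where
  "Q_rel X = {(x, y). x \<in> Q_set X \<and> y \<in> Q_set X \<and> tail_equiv x y}"

text \<open>\<open>R\<close> consists of exactly one representative of each class in \<open>Q/\<sim>\<close>.\<close>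

definition representatives :: "'a word set \<Rightarrow> 'a word set \<Rightarrow> bool" where
  "representatives X R \<longleftrightarrow> R \<subseteq> Q_set X \<and> (\<forall>K \<in> Q_set X // Q_rel X. \<exists>!p. p \<in> R \<inter> K)"

lemma tail_equiv_sym: "tail_equiv x y \<Longrightarrow> tail_equiv y x"
  unfolding tail_equiv_def by (elim exE) (rule exI, rule exI, erule sym)

lemma tail_equiv_trans:
  assumes "tail_equiv x y" "tail_equiv y z" shows "tail_equiv x z"
proof -
  obtain m n where 1: "suffix m x = suffix n y" using assms(1) unfolding tail_equiv_def by (elim exE)
  obtain k l where 2: "suffix k y = suffix l z" using assms(2) unfolding tail_equiv_def by (elim exE)
  have "suffix (m + k) x = suffix k (suffix n y)" by (simp flip: 1)
  also have "\<dots> = suffix n (suffix k y)" by (simp add: add.commute)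
  also have "\<dots> = suffix (l + n) z" by (simp add: 2)
  finally show ?thesis unfolding tail_equiv_def by (intro exI)
qed

lemma equiv_Q_rel: "equiv (Q_set X) (Q_rel X)"
proof (rule equivI)
  show "Q_rel X \<subseteq> Q_set X \<times> Q_set X" by (auto simp: Q_rel_def)
  show "refl_on (Q_set X) (Q_rel X)"
    by (auto simp: refl_on_def Q_rel_def tail_equiv_def)
  show "sym (Q_rel X)"
    by (rule symI) (simp add: Q_rel_def tail_equiv_sym)
  show "trans (Q_rel X)"
    by (rule transI) (auto simp: Q_rel_def intro: tail_equiv_trans)
qed

lemma representatives_exist: "\<exists>R. representatives X R"
proof -
  have "\<exists>c. \<forall>K \<in> Q_set X // Q_rel X. c K \<in> K"
  proof (rule bchoice, rule ballI)
    fix K assume "K \<in> Q_set X // Q_rel X"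
    from in_quotient_imp_non_empty[OF equiv_Q_rel this] show "\<exists>p. p \<in> K"
      by (simp only: ex_in_conv simp_thms)
  qed
  then obtain c where c: "\<And>K. K \<in> Q_set X // Q_rel X \<Longrightarrow> c K \<in> K"
    by (elim exE) (rule that, erule (1) bspec)
  define R where "R = c ` (Q_set X // Q_rel X)"
  have "\<exists>!p. p \<in> R \<inter> K" if K: "K \<in> Q_set X // Q_rel X" for K
  proof (rule ex1I)
    show "c K \<in> R \<inter> K"
      unfolding R_def by (intro IntI imageI K c)
    fix p assume "p \<in> R \<inter> K"
    then have "p \<in> R" "p \<in> K" by simp_all
    from \<open>p \<in> R\<close> obtain L where L: "p = c L" "L \<in> Q_set X // Q_rel X"
      unfolding R_def by (rule imageE)
    from c[OF L(2)] L(1) have "p \<in> L" by (simp only:)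
    with \<open>p \<in> K\<close> have "L \<inter> K \<noteq> {}" by auto
    with quotient_disj[OF equiv_Q_rel L(2) K] have "L = K" by (simp only: simp_thms)
    with L(1) show "p = c K" by (simp only:)
  qed
  moreover have "R \<subseteq> Q_set X"
  proof
    fix p assume "p \<in> R"
    then obtain L where L: "p = c L" "L \<in> Q_set X // Q_rel X"
      unfolding R_def by (rule imageE)
    show "p \<in> Q_set X"
      using subsetD[OF in_quotient_imp_subset[OF equiv_Q_rel L(2)] c[OF L(2)]] L(1)
      by (simp only:)
  qed
  ultimately have "representatives X R" unfolding representatives_def by (intro conjI ballI)
  then show ?thesis ..
qed


section \<open>The associated graph\<close>

fun J_level :: "'a word set \<Rightarrow> 'a word \<Rightarrow> nat \<Rightarrow> 'a word set" where
  "J_level X p 0 = range (\<lambda>n. suffix n p)"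
| "J_level X p (Suc n) = {x \<in> X. shift x \<in> J_level X p n} - (\<Union>k\<in>{..n}. J_level X p k)"

definition J_set :: "'a word set \<Rightarrow> 'a word \<Rightarrow> 'a word set" where
  "J_set X p = (\<Union>n. J_level X p n)"

text \<open>Both the vertex \<open>v_z\<close> and the edge \<open>e_z\<close> are represented by \<open>z\<close>.
  In \<^const>\<open>tail\<close>/\<^const>\<open>head\<close> terminology the source of an edge is its tail and the range
  is its head.\<close>

definition orbit_graph :: "'a word set \<Rightarrow> 'a word \<Rightarrow> ('a word, 'a word) pre_digraph" where
  "orbit_graph X p =
     \<lparr>verts = J_set X p, arcs = J_set X p, tail = (\<lambda>z. z), head = (\<lambda>z. shift z)\<rparr>"

definition disjoint_union_graph ::
  "'i set \<Rightarrow> ('i \<Rightarrow> ('v, 'e) pre_digraph) \<Rightarrow> ('i \<times> 'v, 'i \<times> 'e) pre_digraph" where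
  "disjoint_union_graph I G =
     \<lparr>verts = (SIGMA i:I. verts (G i)), arcs = (SIGMA i:I. arcs (G i)),
      tail = (\<lambda>(i, e). (i, tail (G i) e)), head = (\<lambda>(i, e). (i, head (G i) e))\<rparr>"

definition associated_graph ::
  "'a word set \<Rightarrow> 'a word set \<Rightarrow> ('a word \<times> 'a word, 'a word \<times> 'a word) pre_digraph" where
  "associated_graph X R = disjoint_union_graph R (orbit_graph X)"

lemma shift_J_set:
  assumes "z \<in> J_set X p" shows "shift z \<in> J_set X p"
proof -
  obtain n where n: "z \<in> J_level X p n" using assms by (auto simp: J_set_def)
  show ?thesis
  proof (cases n)
    case 0
    with n obtain k where "z = suffix k p" by auto
    then have "shift z = suffix (k + 1) p" by simp
    then have "shift z \<in> J_level X p 0" by simp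
    then show ?thesis unfolding J_set_def by blast
  next
    case (Suc m)
    with n have "shift z \<in> J_level X p m" by simp
    then show ?thesis unfolding J_set_def by blast
  qed
qed

lemma wf_associated_graph: "wf_digraph (associated_graph X R)"
  by unfold_locales
    (use shift_J_set in \<open>auto simp: associated_graph_def disjoint_union_graph_def orbit_graph_def\<close>)

text \<open>Infinite paths are indexed from \<open>0\<close>, so that \<open>e k\<close> is the edge usually written
  \<open>e_(k+1)\<close>.\<close>

definition infinite_path :: "('v, 'e) pre_digraph \<Rightarrow> (nat \<Rightarrow> 'e) \<Rightarrow> bool" where
  "infinite_path G e \<longleftrightarrow> (\<forall>i. e i \<in> arcs G \<and> head G (e i) = tail G (e (Suc i)))"

definition condition_Y :: "('v, 'e) pre_digraph \<Rightarrow> bool" where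
  "condition_Y G \<longleftrightarrow> (\<forall>e. infinite_path G e \<longrightarrow>
     (\<exists>k u \<alpha>. pre_digraph.awalk G u \<alpha> (tail G (e k)) \<and> length \<alpha> = k + 1))"


section \<open>Ott--Tomforde--Willis subshifts\<close>

datatype 'a otw_word = Fin "'a list" | Inf "'a word"

fun otw_length :: "'a otw_word \<Rightarrow> enat" where
  "otw_length (Fin w) = enat (length w)"
| "otw_length (Inf x) = \<infinity>"

fun otw_shift :: "'a otw_word \<Rightarrow> 'a otw_word" where
  "otw_shift (Fin w) = Fin (tl w)"
| "otw_shift (Inf x) = Inf (shift x)"

fun begins_with :: "'a otw_word \<Rightarrow> 'a list \<Rightarrow> bool" where
  "begins_with (Fin w) \<alpha> \<longleftrightarrow> (\<exists>v. w = \<alpha> @ v)"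
| "begins_with (Inf x) \<alpha> \<longleftrightarrow> (\<exists>y. x = \<alpha> \<frown> y)"

fun letter :: "'a otw_word \<Rightarrow> nat \<Rightarrow> 'a" where
  "letter (Fin w) n = w ! n"
| "letter (Inf x) n = x n"

definition X_fin :: "'a word set \<Rightarrow> 'a list set" where
  "X_fin X = {\<alpha>. infinite {a. \<exists>y. \<alpha> \<frown> [a] \<frown> y \<in> X}}"

definition otw_subshift :: "'a word set \<Rightarrow> 'a otw_word set" where
  "otw_subshift X = Inf ` X \<union> Fin ` X_fin X"

definition otw_basic :: "'a word set \<Rightarrow> 'a list \<Rightarrow> 'a set \<Rightarrow> 'a otw_word set" where
  "otw_basic X \<alpha> G = {y \<in> otw_subshift X. begins_with y \<alpha> \<and>
     (otw_length y > enat (length \<alpha>) \<longrightarrow> letter y (length \<alpha>) \<notin> G)}"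

definition otw_topology :: "'a word set \<Rightarrow> 'a otw_word topology" where
  "otw_topology X =
     topology (arbitrary union_of (\<lambda>B. \<exists>\<alpha> G. finite G \<and> B = otw_basic X \<alpha> G))"

text \<open>The basic sets do form the basis of a topology, on the whole space.\<close>

lemma begins_with_iff:
  "begins_with y \<alpha> \<longleftrightarrow>
     enat (length \<alpha>) \<le> otw_length y \<and> (\<forall>i<length \<alpha>. letter y i = \<alpha> ! i)"
proof (cases y)
  case (Fin w)
  have "(\<exists>v. w = \<alpha> @ v) \<longleftrightarrow> length \<alpha> \<le> length w \<and> take (length \<alpha>) w = \<alpha>"
    by (metis append_eq_conv_conj append_take_drop_id take_all_iff nat_le_linear)
  also have "\<dots> \<longleftrightarrow> length \<alpha> \<le> length w \<and> (\<forall>i<length \<alpha>. w ! i = \<alpha> ! i)"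
    by (auto simp: list_eq_iff_nth_eq)
  finally show ?thesis using Fin by simp
next
  case (Inf x)
  have "(\<exists>y. x = \<alpha> \<frown> y) \<longleftrightarrow> (\<forall>i<length \<alpha>. x i = \<alpha> ! i)"
  proof
    assume "\<forall>i<length \<alpha>. x i = \<alpha> ! i"
    then have "x = \<alpha> \<frown> suffix (length \<alpha>) x"
      by (auto simp: conc_def fun_eq_iff)
    then show "\<exists>y. x = \<alpha> \<frown> y" by blast
  qed auto
  then show ?thesis using Inf by simp
qed

lemma otw_basic_mono:
  assumes "z \<in> otw_basic X \<alpha> G" "z \<in> otw_basic X \<beta> H" "length \<alpha> < length \<beta>"
  shows "otw_basic X \<beta> H \<subseteq> otw_basic X \<alpha> G"
proof
  fix y assume y: "y \<in> otw_basic X \<beta> H"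
  have z: "enat (length \<beta>) \<le> otw_length z" "\<And>i. i < length \<beta> \<Longrightarrow> letter z i = \<beta> ! i"
      "\<And>i. i < length \<alpha> \<Longrightarrow> letter z i = \<alpha> ! i"
    using assms by (auto simp: otw_basic_def begins_with_iff)
  have "enat (length \<alpha>) < otw_length z"
    using z(1) assms(3) by (meson enat_ord_simps(2) less_le_trans)
  then have "letter z (length \<alpha>) \<notin> G" using assms(1) by (auto simp: otw_basic_def)
  then have "\<beta> ! length \<alpha> \<notin> G" using z(2) assms(3) by simp
  moreover have "\<beta> ! i = \<alpha> ! i" if "i < length \<alpha>" for i
    using z(2)[of i] z(3)[of i] that assms(3) by simp
  moreover have "y \<in> otw_subshift X" "enat (length \<beta>) \<le> otw_length y"
      "\<And>i. i < length \<beta> \<Longrightarrow> letter y i = \<beta> ! i"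
    using y by (auto simp: otw_basic_def begins_with_iff)
  moreover have "enat (length \<alpha>) \<le> otw_length y"
    using calculation(4) assms(3) by (meson enat_ord_simps(1) less_imp_le order_trans)
  ultimately show "y \<in> otw_basic X \<alpha> G"
    using assms(3) by (auto simp: otw_basic_def begins_with_iff)
qed

lemma otw_basic_Int:
  assumes "z \<in> otw_basic X \<alpha> G" "z \<in> otw_basic X \<beta> H" "finite G" "finite H"
  shows "\<exists>\<gamma> K. finite K \<and> otw_basic X \<alpha> G \<inter> otw_basic X \<beta> H = otw_basic X \<gamma> K"
proof -
  consider "length \<alpha> < length \<beta>" | "length \<beta> < length \<alpha>" | "length \<alpha> = length \<beta>"
    by linarith
  then show ?thesis
  proof cases
    case 1
    then show ?thesis using otw_basic_mono[OF assms(1,2)] assms(4) by blast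
  next
    case 2
    then show ?thesis using otw_basic_mono[OF assms(2,1)] assms(3) by blast
  next
    case 3
    then have "\<alpha> = \<beta>"
      using assms(1,2) by (auto simp: otw_basic_def begins_with_iff list_eq_iff_nth_eq)
    then have "otw_basic X \<alpha> G \<inter> otw_basic X \<beta> H = otw_basic X \<alpha> (G \<union> H)"
      by (auto simp: otw_basic_def)
    then show ?thesis using assms(3,4) by blast
  qed
qed

lemma openin_otw_topology:
  "openin (otw_topology X) =
     arbitrary union_of (\<lambda>B. \<exists>\<alpha> G. finite G \<and> B = otw_basic X \<alpha> G)"
proof -
  let ?P = "\<lambda>B. \<exists>\<alpha> G. finite G \<and> B = otw_basic X \<alpha> G"
  have "(arbitrary union_of ?P) (S \<inter> T)" if ST: "?P S" "?P T" for S T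
  proof (cases "S \<inter> T = {}")
    case True
    then show ?thesis by simp
  next
    case False
    then obtain z where z: "z \<in> S" "z \<in> T" by auto
    from ST obtain \<alpha> G \<beta> H where S: "finite G" "S = otw_basic X \<alpha> G"
      and T: "finite H" "T = otw_basic X \<beta> H" by (elim exE conjE) simp
    have "?P (S \<inter> T)"
      using otw_basic_Int[of z X \<alpha> G \<beta> H] z S T by simp
    then show ?thesis by (simp add: arbitrary_def union_of_inc)
  qed
  then have "istopology (arbitrary union_of ?P)"
    unfolding istopology_base_eq by (intro allI impI) (elim conjE, assumption)
  then show ?thesis unfolding otw_topology_def by (rule topology_inverse')
qed

lemma topspace_otw_topology: "topspace (otw_topology X) = otw_subshift X"
proof
  show "topspace (otw_topology X) \<subseteq> otw_subshift X"
    unfolding topspace_def openin_otw_topology union_of_def by (auto simp: otw_basic_def)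
  have "otw_basic X [] {} = otw_subshift X"
    by (auto simp: otw_basic_def begins_with_iff zero_enat_def[symmetric])
  then have "openin (otw_topology X) (otw_subshift X)"
    unfolding openin_otw_topology
    by (intro union_of_inc) (auto simp: arbitrary_def intro!: exI[of _ "[]"] exI[of _ "{}"])
  then show "otw_subshift X \<subseteq> topspace (otw_topology X)" by (rule openin_subset)
qed

definition otw_conjugate :: "'a word set \<Rightarrow> 'b word set \<Rightarrow> bool" where
  "otw_conjugate X Y \<longleftrightarrow> (\<exists>h. homeomorphic_map (otw_topology X) (otw_topology Y) h \<and>
     (\<forall>y\<in>otw_subshift X. h (otw_shift y) = otw_shift (h y) \<and> otw_length (h y) = otw_length y))"

end

(* Each vertex of the associated graph emits exactly one edge, so Condition (Y) speaks about points:
   every z in X tail-equivalent to some p in Q_X admits k and y in X with sigma^(k+1) y = sigma^k z.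
   A conjugacy restricts to a shift-commuting bijection of the infinite words, so it only has to be
   shown that it respects Q_X, that is, the Boolean algebra U.  The preimage of a cylinder Z(beta) is
   clopen, hence by compactness a finite union of generalized cylinders; as lengths are preserved,
   it contains no finite word shorter than beta, so the defining words of these cylinders can be
   taken of length at least |beta|.  Then deleting |beta| letters only removes letters that are
   already prescribed, which makes the preimage of C(alpha, beta) a finite union of intersections
   of sets C(gamma, delta) and generalized cylinders. *)

theory Submission
  imports Defs
begin

section \<open>Subshifts and generalized cylinders\<close>

lemma occurs_in_suffix:
  assumes "occurs_in w (suffix n x)" shows "occurs_in w x"
proof -
  obtain m where "(suffix n x) [m \<rightarrow> m + length w] = w" using assms by (auto simp: occurs_in_def)
  then have "x [n + m \<rightarrow> (n + m) + length w] = w" by (simp add: add.assoc)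
  then show ?thesis unfolding occurs_in_def by blast
qed

lemma subshift_suffix: "subshift X \<Longrightarrow> x \<in> X \<Longrightarrow> suffix n x \<in> X"
  unfolding subshift_def avoiding_def using occurs_in_suffix by blast

text \<open>A forbidden block has finite length, so an occurrence in \<open>x\<close> lies within
  some prefix of \<open>x\<close>, and a point of \<open>X\<close> sharing that prefix would contain
  it too.\<close>

lemma subshift_closed:
  assumes X: "subshift X" and x: "\<And>n. \<exists>y\<in>X. prefix n y = prefix n x"
  shows "x \<in> X"
proof -
  obtain F where F: "X = avoiding F" using X by (auto simp: subshift_def)
  have False if w: "w \<in> F" "occurs_in w x" for w
  proof -
    obtain n where n: "x [n \<rightarrow> n + length w] = w" using w(2) by (auto simp: occurs_in_def)
    obtain y where y: "y \<in> X" "prefix (n + length w) y = prefix (n + length w) x"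
      using x by blast
    have "drop n (prefix (n + length w) y) = drop n (prefix (n + length w) x)"
      using y(2) by simp
    then have "y [n \<rightarrow> n + length w] = w" using n by simp
    then have "occurs_in w y" by (auto simp: occurs_in_def)
    then show False using y(1) w(1) F by (auto simp: avoiding_def)
  qed
  then show ?thesis using F by (auto simp: avoiding_def)
qed

lemma prefix_in_language: "x \<in> X \<Longrightarrow> prefix n x \<in> language X"
  unfolding language_def occurs_in_def
  by (intro CollectI bexI[of _ x] exI[of _ 0]) simp_all

text \<open>The trace of \<open>otw_basic X \<delta> G\<close> on the infinite words, where a letter
  after \<open>\<delta>\<close> always exists and the guard on the length disappears.\<close>

definition gen_cyl :: "'a word set \<Rightarrow> 'a list \<Rightarrow> 'a set \<Rightarrow> 'a word set" where
  "gen_cyl X \<delta> G = {x \<in> X. prefix (length \<delta>) x = \<delta> \<and> x (length \<delta>) \<notin> G}"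

lemma prefix_eq_iff: "prefix (length \<delta>) x = \<delta> \<longleftrightarrow> (\<forall>i<length \<delta>. x i = \<delta> ! i)"
  unfolding list_eq_iff_nth_eq[of "prefix (length \<delta>) x"] by simp

lemma Inf_in_otw_basic: "Inf x \<in> otw_basic X \<delta> G \<longleftrightarrow> x \<in> gen_cyl X \<delta> G"
  unfolding otw_basic_def gen_cyl_def otw_subshift_def begins_with_iff prefix_eq_iff by auto

lemma gen_cyl_snoc:
  "x \<in> gen_cyl X (\<delta> @ [a]) {} \<longleftrightarrow> x \<in> gen_cyl X \<delta> {} \<and> x (length \<delta>) = a"
  by (simp add: gen_cyl_def)

section \<open>Neighbourhoods in the topology of an OTW-subshift\<close>

lemma openin_otw_iff:
  "openin (otw_topology X) V \<longleftrightarrow>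
     (\<forall>y\<in>V. \<exists>\<alpha> G. finite G \<and> y \<in> otw_basic X \<alpha> G \<and> otw_basic X \<alpha> G \<subseteq> V)"
  unfolding openin_otw_topology arbitrary_union_of_alt
  by (intro ball_cong refl iffI; elim exE conjE; blast)

lemma openin_otw_basic: "finite G \<Longrightarrow> openin (otw_topology X) (otw_basic X \<alpha> G)"
  unfolding openin_otw_iff by blast

text \<open>A word outside the cylinder either has at least \<open>length \<alpha>\<close> letters,
  and then its own prefix of that length separates it, or is a shorter finite word.\<close>

lemma closedin_otw_cylinder: "closedin (otw_topology X) (otw_basic X \<alpha> {})"
  unfolding closedin_def topspace_otw_topology openin_otw_iff
proof (intro conjI ballI)
  show "otw_basic X \<alpha> {} \<subseteq> otw_subshift X" by (auto simp: otw_basic_def)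
  fix y assume "y \<in> otw_subshift X - otw_basic X \<alpha> {}"
  then have y: "y \<in> otw_subshift X" "\<not> begins_with y \<alpha>" by (auto simp: otw_basic_def)
  show "\<exists>\<beta> G. finite G \<and> y \<in> otw_basic X \<beta> G
      \<and> otw_basic X \<beta> G \<subseteq> otw_subshift X - otw_basic X \<alpha> {}"
  proof (cases "enat (length \<alpha>) \<le> otw_length y")
    case True
    then have "y \<in> otw_basic X (map (letter y) [0..<length \<alpha>]) {}"
      using y by (auto simp: otw_basic_def begins_with_iff)
    moreover have "z \<notin> otw_basic X \<alpha> {}"
      if "z \<in> otw_basic X (map (letter y) [0..<length \<alpha>]) {}" for z
      using y True that by (auto simp: otw_basic_def begins_with_iff)
    moreover have "otw_basic X (map (letter y) [0..<length \<alpha>]) {} \<subseteq> otw_subshift X"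
      by (auto simp: otw_basic_def)
    ultimately show ?thesis by blast
  next
    case False
    then obtain w where w: "y = Fin w" "length w < length \<alpha>" by (cases y) auto
    \<comment> \<open>All words beginning with \<open>\<alpha>\<close> have the letter
      \<open>\<alpha> ! length w\<close> at position \<open>length w\<close>, so excluding this one
      letter separates \<open>w\<close> from them, whether or not \<open>w\<close> is a prefix of
      \<open>\<alpha>\<close>.\<close>
    have "y \<in> otw_basic X w {\<alpha> ! length w}" using y w by (auto simp: otw_basic_def)
    moreover have "z \<notin> otw_basic X \<alpha> {}" if "z \<in> otw_basic X w {\<alpha> ! length w}" for z
    proof
      assume "z \<in> otw_basic X \<alpha> {}"
      then have "enat (length \<alpha>) \<le> otw_length z" "letter z (length w) = \<alpha> ! length w"
        using w(2) by (auto simp: otw_basic_def begins_with_iff)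
      moreover have "enat (length w) < otw_length z"
        using calculation(1) w(2) by (meson enat_ord_simps(2) less_le_trans)
      ultimately show False using that by (auto simp: otw_basic_def)
    qed
    moreover have "otw_basic X w {\<alpha> ! length w} \<subseteq> otw_subshift X"
      by (auto simp: otw_basic_def)
    ultimately show ?thesis by blast
  qed
qed

text \<open>The inequality is strict because the letter at position \<open>length \<gamma>\<close>,
  which is compared with \<open>G\<close>, must be fixed as well.\<close>

lemma eventually_in_otw_basic:
  assumes "x \<in> gen_cyl X \<gamma> G" and "length \<gamma> < n"
  shows "gen_cyl X (prefix n x) {} \<subseteq> gen_cyl X \<gamma> G"
proof
  fix y assume "y \<in> gen_cyl X (prefix n x) {}"
  then have "y \<in> X" "prefix n y = prefix n x" by (auto simp: gen_cyl_def)
  then have "y i = x i" if "i < n" for i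
    using that subsequence_nth[of i n 0 y] subsequence_nth[of i n 0 x] by auto
  then show "y \<in> gen_cyl X \<gamma> G"
    using assms \<open>y \<in> X\<close> by (simp add: gen_cyl_def prefix_eq_iff)
qed

text \<open>Either \<open>w\<close> is \<open>\<gamma>\<close> and \<open>G\<close> itself serves as
  \<open>H\<close>, or \<open>w\<close> already contains the letter after \<open>\<gamma>\<close>,
  which is not in \<open>G\<close>, and the empty set serves.\<close>

lemma otw_basic_at_Fin:
  assumes "Fin w \<in> otw_basic X \<gamma> G" and "finite G"
  shows "\<exists>H. finite H \<and> gen_cyl X w H \<subseteq> gen_cyl X \<gamma> G"
proof -
  obtain v where v: "w = \<gamma> @ v" using assms(1) by (auto simp: otw_basic_def)
  show ?thesis
  proof (cases v)
    case Nil
    then show ?thesis using v assms(2) by auto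
  next
    case (Cons a u)
    then have "a \<notin> G" using assms(1) v by (auto simp: otw_basic_def)
    then have "gen_cyl X w {} \<subseteq> gen_cyl X \<gamma> G"
      using v Cons unfolding gen_cyl_def prefix_eq_iff by (fastforce simp: nth_append)
    then show ?thesis by blast
  qed
qed

text \<open>A Koenig-type argument that replaces compactness of the space: if no finite union works,
  this is already so on a nested sequence of cylinders, and these shrink to a point of \<open>X\<close>.
  A finite word in \<open>X_fin X\<close> reached on the way is harmless, because all but finitely many of
  its continuations lie on the same side of \<open>V\<close> as the word itself.  The bound \<open>N\<close> on the
  length of the words in \<open>V\<close> is inherited by the cylinders.\<close>

lemma clopen_finite_union_gen_cyl:
  assumes X: "subshift X"
    and V: "openin (otw_topology X) V" "closedin (otw_topology X) V"
    and N: "\<And>w. Fin w \<in> V \<Longrightarrow> N \<le> length w"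
  shows "(finite union_of (\<lambda>B. \<exists>\<delta> G. finite G \<and> N \<le> length \<delta> \<and> B = gen_cyl X \<delta> G))
     {x \<in> X. Inf x \<in> V}" (is "(finite union_of ?P) _")
proof (rule ccontr)
  have Vc: "openin (otw_topology X) (otw_subshift X - V)"
    using V(2) by (simp add: closedin_def topspace_otw_topology)
  have gen: "(finite union_of ?P) (gen_cyl X \<delta> G)" if "finite G" "N \<le> length \<delta>" for \<delta> G
    by (rule finite_union_of_inc) (use that in blast)
  have Un: "(finite union_of ?P) (A \<union> B)" if "(finite union_of ?P) A" "(finite union_of ?P) B" for A B
    using finite_union_of_Union[of "{A, B}"] that by auto
  define part where "part \<alpha> = {x \<in> gen_cyl X \<alpha> {}. Inf x \<in> V}" for \<alpha>
  define bad where "bad \<alpha> \<longleftrightarrow> \<not> (finite union_of ?P) (part \<alpha>)" for \<alpha>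
  have UN: "(finite union_of ?P) (\<Union>a\<in>A. part (\<alpha> @ [a]))"
    if "finite A" "\<And>a. a \<in> A \<Longrightarrow> \<not> bad (\<alpha> @ [a])" for A \<alpha>
    using that by (intro finite_union_of_Union) (auto simp: bad_def)
  have part_snoc: "part (\<alpha> @ [a]) = {x \<in> part \<alpha>. x (length \<alpha>) = a}" for \<alpha> a
    by (auto simp: part_def gen_cyl_snoc)
  have step: "\<exists>a. bad (\<alpha> @ [a])" if bad: "bad \<alpha>" for \<alpha>
  proof (rule ccontr)
    assume "\<nexists>a. bad (\<alpha> @ [a])"
    then have nb: "\<not> bad (\<alpha> @ [a])" for a by blast
    have "(finite union_of ?P) (part \<alpha>)"
    proof (cases "\<alpha> \<in> X_fin X")
      case False
      \<comment> \<open>Outside \<open>X_fin\<close> only finitely many letters can follow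
        \<open>\<alpha>\<close>, so \<open>part \<alpha>\<close> splits into finitely many good
        parts.\<close>
      let ?A = "{a. \<exists>y. \<alpha> \<frown> [a] \<frown> y \<in> X}"
      have "x (length \<alpha>) \<in> ?A" if "x \<in> part \<alpha>" for x
      proof -
        have "x \<in> X" "prefix (length \<alpha>) x = \<alpha>" using that by (auto simp: part_def gen_cyl_def)
        then have "prefix (Suc (length \<alpha>)) x = \<alpha> @ [x (length \<alpha>)]" by simp
        then have "\<alpha> \<frown> [x (length \<alpha>)] \<frown> suffix (Suc (length \<alpha>)) x = x"
          by (metis conc_conc prefix_suffix)
        then have "\<alpha> \<frown> [x (length \<alpha>)] \<frown> suffix (Suc (length \<alpha>)) x \<in> X"
          using \<open>x \<in> X\<close> by (simp only:)
        then show ?thesis by (intro CollectI exI)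
      qed
      then have "part \<alpha> = (\<Union>a\<in>?A. part (\<alpha> @ [a]))" unfolding part_snoc by blast
      moreover have "finite ?A" using False by (simp add: X_fin_def)
      ultimately show ?thesis using UN[of ?A \<alpha>] nb by simp
    next
      case True
      then have \<alpha>: "Fin \<alpha> \<in> otw_subshift X" by (simp add: otw_subshift_def)
      show ?thesis
      proof (cases "Fin \<alpha> \<in> V")
        case True
        then obtain \<gamma> G where "finite G" "Fin \<alpha> \<in> otw_basic X \<gamma> G" "otw_basic X \<gamma> G \<subseteq> V"
          using V(1) unfolding openin_otw_iff by blast
        moreover from this obtain H where "finite H" "gen_cyl X \<alpha> H \<subseteq> gen_cyl X \<gamma> G"
          using otw_basic_at_Fin by metis
        ultimately have H: "finite H" "\<And>x. x \<in> gen_cyl X \<alpha> H \<Longrightarrow> Inf x \<in> V"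
          using Inf_in_otw_basic by blast+
        \<comment> \<open>Letters outside \<open>H\<close> lead into \<open>V\<close>, and those in
          \<open>H\<close> give finitely many good parts. As \<open>Fin \<alpha>\<close> lies in
          \<open>V\<close>, its length is at least \<open>N\<close>, which makes
          \<open>gen_cyl X \<alpha> H\<close> an admissible piece.\<close>
        have "part \<alpha> = gen_cyl X \<alpha> H \<union> (\<Union>a\<in>H. part (\<alpha> @ [a]))"
          using H(2) by (auto simp: part_snoc) (auto simp: part_def gen_cyl_def)
        then show ?thesis using Un[OF gen UN] H(1) nb N[OF True] by simp
      next
        case False
        then obtain \<gamma> G where "finite G" "Fin \<alpha> \<in> otw_basic X \<gamma> G"
            "otw_basic X \<gamma> G \<subseteq> otw_subshift X - V"
          using Vc \<alpha> unfolding openin_otw_iff by blast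
        moreover from this obtain H where "finite H" "gen_cyl X \<alpha> H \<subseteq> gen_cyl X \<gamma> G"
          using otw_basic_at_Fin by metis
        ultimately have H: "finite H" "\<And>x. x \<in> gen_cyl X \<alpha> H \<Longrightarrow> Inf x \<notin> V"
          using Inf_in_otw_basic by blast+
        \<comment> \<open>Letters outside \<open>H\<close> now lead out of \<open>V\<close>, so no
          generalized cylinder at \<open>\<alpha>\<close> itself is used and
          \<open>length \<alpha>\<close> may be below \<open>N\<close>.\<close>
        have "part \<alpha> = (\<Union>a\<in>H. part (\<alpha> @ [a]))"
          using H(2) by (auto simp: part_snoc) (auto simp: part_def gen_cyl_def)
        then show ?thesis using UN H(1) nb by simp
      qed
    qed
    then show False using bad by (simp add: bad_def)
  qed
  assume "\<not> (finite union_of ?P) {x \<in> X. Inf x \<in> V}"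
  then have "bad []" by (simp add: bad_def part_def gen_cyl_def)
  obtain c where c: "\<And>\<alpha>. bad \<alpha> \<Longrightarrow> bad (\<alpha> @ [c \<alpha>])" using step by metis
  \<comment> \<open>The words \<open>w n\<close> follow the bad extensions picked by
    \<open>c\<close>; they are the prefixes of the infinite word \<open>x\<close>.\<close>
  define w where "w = rec_nat [] (\<lambda>_ v. v @ [c v])"
  define x where "x n = c (w n)" for n
  have "prefix n x = w n" for n by (induction n) (auto simp: w_def x_def)
  moreover have "bad (w n)" for n by (induction n) (auto simp: w_def \<open>bad []\<close> c)
  ultimately have badx: "bad (prefix n x)" for n by simp
  \<comment> \<open>The empty set is a finite union of pieces, so a bad part contains a point; these
    points of \<open>X\<close> approximate \<open>x\<close>.\<close>
  have "part (prefix n x) \<noteq> {}" for n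
    using badx[of n] finite_union_of_empty unfolding bad_def by metis
  then have "x \<in> X"
    by (intro subshift_closed[OF X]) (fastforce simp: part_def gen_cyl_def)
  then have Ix: "Inf x \<in> otw_subshift X" by (simp add: otw_subshift_def)
  have sub: "\<exists>n\<ge>N. gen_cyl X (prefix n x) {} \<subseteq> {y. Inf y \<in> U}"
    if "openin (otw_topology X) U" "Inf x \<in> U" for U
  proof -
    obtain \<gamma> G where \<gamma>: "x \<in> gen_cyl X \<gamma> G" "otw_basic X \<gamma> G \<subseteq> U"
      using \<open>openin _ U\<close> \<open>Inf x \<in> U\<close> unfolding openin_otw_iff
      by (auto simp: Inf_in_otw_basic[symmetric])
    have "gen_cyl X \<gamma> G \<subseteq> {y. Inf y \<in> U}" using \<gamma>(2) Inf_in_otw_basic by blast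
    \<comment> \<open>\<open>Suc (length \<gamma>)\<close> letters put the cylinder inside
      \<open>gen_cyl X \<gamma> G\<close>, and \<open>N\<close> letters make it an admissible
      piece.\<close>
    moreover have "gen_cyl X (prefix (max N (Suc (length \<gamma>))) x) {} \<subseteq> gen_cyl X \<gamma> G"
      by (rule eventually_in_otw_basic[OF \<gamma>(1)]) simp
    ultimately show ?thesis by (meson max.cobounded1 subset_trans)
  qed
  show False
  proof (cases "Inf x \<in> V")
    case True
    then obtain n where n: "n \<ge> N" "gen_cyl X (prefix n x) {} \<subseteq> {y. Inf y \<in> V}"
      using sub V(1) by blast
    then have "part (prefix n x) = gen_cyl X (prefix n x) {}" by (auto simp: part_def)
    then show False using badx[of n] gen[of "{}" "prefix n x"] n(1) by (simp add: bad_def)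
  next
    case False
    then obtain n where "gen_cyl X (prefix n x) {} \<subseteq> {y. Inf y \<in> otw_subshift X - V}"
      using sub Vc Ix by blast
    then have "part (prefix n x) = {}" by (auto simp: part_def)
    then show False using badx[of n] finite_union_of_empty by (simp add: bad_def)
  qed
qed


section \<open>The Boolean algebra\<close>

text \<open>The closure properties pass to intersections of algebras. That the hull consists of
  subsets of \<open>X\<close> comes from \<open>Pow X\<close>, one of the algebras containing the
  generators.\<close>

lemma algebra_boolean_alg: "algebra X (boolean_alg X)"
  unfolding boolean_alg_def
proof -
  let ?S = "{cyl X \<alpha> \<beta> |\<alpha> \<beta>. \<alpha> \<in> language X \<and> \<beta> \<in> language X}"
  have "?S \<subseteq> Pow X" by (auto simp: cyl_def)
  then have "algebra X hull ?S \<subseteq> Pow X"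
    by (intro hull_minimal) (auto simp: algebra_iff_Int)
  then show "algebra X (algebra X hull ?S)"
    unfolding algebra_iff_Un by (auto simp: hull_def algebra_iff_Un)
qed

lemma mem_cyl_iff:
  "x \<in> cyl X \<alpha> \<beta> \<longleftrightarrow> x \<in> X \<and> prefix (length \<beta>) x = \<beta> \<and> \<alpha> \<frown> suffix (length \<beta>) x \<in> X"
proof
  assume "x \<in> X \<and> prefix (length \<beta>) x = \<beta> \<and> \<alpha> \<frown> suffix (length \<beta>) x \<in> X"
  moreover from this have "x = \<beta> \<frown> suffix (length \<beta>) x" by (metis prefix_suffix)
  ultimately show "x \<in> cyl X \<alpha> \<beta>" unfolding cyl_def by auto
qed (auto simp: cyl_def)

text \<open>A point of the set exhibits both words as prefixes of points of \<open>X\<close>, hence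
  in the language; the empty set lies in every algebra.\<close>

lemma cyl_in_boolean_alg: "cyl X \<alpha> \<beta> \<in> boolean_alg X"
proof (cases "cyl X \<alpha> \<beta> = {}")
  case True
  then show ?thesis using algebra_boolean_alg[of X] by (simp add: algebra_iff_Un)
next
  case False
  then obtain x where x: "x \<in> X" "prefix (length \<beta>) x = \<beta>" "\<alpha> \<frown> suffix (length \<beta>) x \<in> X"
    by (auto simp: mem_cyl_iff)
  have "\<beta> \<in> language X" using prefix_in_language[OF x(1)] x(2) by metis
  moreover have "\<alpha> \<in> language X"
    using prefix_in_language[OF x(3), of "length \<alpha>"] by simp
  ultimately show ?thesis unfolding boolean_alg_def by (intro hull_inc) blast
qed

lemma gen_cyl_in_boolean_alg:
  assumes X: "subshift X" and G: "finite G"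
  shows "gen_cyl X \<delta> G \<in> boolean_alg X"
proof -
  interpret algebra X "boolean_alg X" by (rule algebra_boolean_alg)
  \<comment> \<open>By shift invariance \<open>cyl X [] \<delta>\<close> consists of all points of
    \<open>X\<close> beginning with \<open>\<delta>\<close>.\<close>
  have "gen_cyl X \<delta> G = cyl X [] \<delta> - (\<Union>a\<in>G. cyl X [] (\<delta> @ [a]))"
    using subshift_suffix[OF X] by (auto simp: gen_cyl_def mem_cyl_iff)
  also have "\<dots> \<in> boolean_alg X" using G by (intro Diff finite_UN) (auto simp: cyl_in_boolean_alg)
  finally show ?thesis .
qed

text \<open>As \<open>m \<le> length \<gamma>\<close>, the point \<open>w\<close> can only be
  \<open>take m \<gamma>\<close> followed by \<open>suffix n x\<close>. That it lies in
  \<open>X\<close> is the condition of \<open>cyl X (take m \<gamma>) (take n \<delta>)\<close>.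
  What \<open>\<gamma>\<close> and \<open>F\<close> demand from position \<open>m\<close> on
  concerns the common tail, and is read off from \<open>x\<close> by the word
  \<open>take n \<delta> @ drop m \<gamma>\<close>.\<close>

lemma gen_cyl_transfer_in_boolean_alg:
  assumes X: "subshift X" and fin: "finite F" "finite G"
    and len: "m \<le> length \<gamma>" "n \<le> length \<delta>"
  shows "{x \<in> gen_cyl X \<delta> G. \<exists>w\<in>gen_cyl X \<gamma> F. suffix m w = suffix n x} \<in> boolean_alg X"
proof -
  interpret algebra X "boolean_alg X" by (rule algebra_boolean_alg)
  let ?\<alpha> = "take m \<gamma>" and ?\<beta> = "take n \<delta>" and ?\<epsilon> = "take n \<delta> @ drop m \<gamma>"
  have \<gamma>: "prefix (length \<gamma>) w = \<gamma> \<longleftrightarrow>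
      prefix m w = ?\<alpha> \<and> (\<forall>i<length \<gamma> - m. suffix m w i = drop m \<gamma> ! i)" for w
  proof -
    have "prefix (length \<gamma>) w = prefix m w @ prefix (length \<gamma> - m) (suffix m w)"
      using len(1) subsequence_append[of w m "length \<gamma> - m"] by simp
    moreover have "\<gamma> = take m \<gamma> @ drop m \<gamma>" by simp
    ultimately have "prefix (length \<gamma>) w = \<gamma> \<longleftrightarrow>
        prefix m w = ?\<alpha> \<and> prefix (length (drop m \<gamma>)) (suffix m w) = drop m \<gamma>"
      using len(1) by (metis append_eq_append_conv length_drop length_take min.absorb2
          diff_zero subsequence_length)
    then show ?thesis unfolding prefix_eq_iff by simp
  qed
  have w: "w \<in> gen_cyl X \<gamma> F \<longleftrightarrow> w \<in> X \<and> prefix m w = ?\<alpha> \<and>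
      (\<forall>i<length \<gamma> - m. suffix m w i = drop m \<gamma> ! i) \<and> suffix m w (length \<gamma> - m) \<notin> F" for w
    using len(1) unfolding gen_cyl_def \<gamma> by auto
  have x: "x \<in> gen_cyl X ?\<epsilon> F \<longleftrightarrow> x \<in> X \<and> prefix n x = ?\<beta> \<and>
      (\<forall>i<length \<gamma> - m. suffix n x i = drop m \<gamma> ! i) \<and> suffix n x (length \<gamma> - m) \<notin> F" for x
  proof -
    have "prefix (length ?\<epsilon>) x = ?\<epsilon> \<longleftrightarrow> prefix n x = ?\<beta> \<and>
        prefix (length (drop m \<gamma>)) (suffix n x) = drop m \<gamma>"
      using len(2) subsequence_append[of x n "length \<gamma> - m"] by simp
    then show ?thesis using len unfolding gen_cyl_def prefix_eq_iff[where \<delta> = "drop m \<gamma>"] by auto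
  qed
  have "{x \<in> gen_cyl X \<delta> G. \<exists>w\<in>gen_cyl X \<gamma> F. suffix m w = suffix n x} =
      gen_cyl X \<delta> G \<inter> cyl X ?\<alpha> ?\<beta> \<inter> gen_cyl X ?\<epsilon> F" (is "?L = ?R")
  proof (intro equalityI subsetI)
    fix y assume "y \<in> ?L"
    then obtain w' where y: "y \<in> gen_cyl X \<delta> G" and w': "w' \<in> gen_cyl X \<gamma> F"
      "suffix m w' = suffix n y" by blast
    have "y \<in> X" "prefix (length \<delta>) y = \<delta>" using y by (auto simp: gen_cyl_def)
    then have yn: "prefix n y = ?\<beta>" using len(2) subsequence_take[of n y 0 "length \<delta>"]
      by (simp add: min_def)
    \<comment> \<open>The witness is thereby determined by \<open>y\<close>, which turns the
      existential statement into membership in a \<open>cyl\<close>.\<close>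
    have "?\<alpha> \<frown> suffix n y = w'" using w' w[of w'] by (metis prefix_suffix)
    then show "y \<in> ?R"
      using y yn w' w[of w'] x[of y] \<open>y \<in> X\<close> len(2) by (simp add: mem_cyl_iff min_def)
  next
    fix y assume y: "y \<in> ?R"
    let ?w = "?\<alpha> \<frown> suffix n y"
    have "suffix m ?w = suffix n y" "prefix m ?w = ?\<alpha>" using len(1) by simp_all
    moreover have "length ?\<beta> = n" using len(2) by simp
    then have "?w \<in> X" using y by (simp add: mem_cyl_iff)
    ultimately have "?w \<in> gen_cyl X \<gamma> F" using y x[of y] w[of ?w] by simp
    then show "y \<in> ?L" using y \<open>suffix m ?w = suffix n y\<close> by blast
  qed
  then show ?thesis
    using X fin by (simp add: Int gen_cyl_in_boolean_alg cyl_in_boolean_alg)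
qed


section \<open>Conjugacies\<close>

text \<open>Preservation of length makes infinite words correspond to infinite words, which gives
  \<open>g\<close>. The preimage of the cylinder of \<open>\<beta>\<close> is clopen, and its finite
  words have length at least \<open>length \<beta>\<close> because their images begin with
  \<open>\<beta>\<close>; the decomposition of clopen sets applies with this bound.\<close>

lemma otw_conjugate_on_words:
  assumes X: "subshift X" and "otw_conjugate X Y"
  obtains g where "bij_betw g X Y" and "\<And>x. x \<in> X \<Longrightarrow> g (shift x) = shift (g x)"
    and "\<And>\<beta>. (finite union_of (\<lambda>B. \<exists>\<delta> G. finite G \<and> length \<beta> \<le> length \<delta> \<and> B = gen_cyl X \<delta> G))
        {x \<in> X. prefix (length \<beta>) (g x) = \<beta>}"
proof -
  obtain h where h: "homeomorphic_map (otw_topology X) (otw_topology Y) h"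
    and sh: "\<And>y. y \<in> otw_subshift X \<Longrightarrow> h (otw_shift y) = otw_shift (h y)"
    and len: "\<And>y. y \<in> otw_subshift X \<Longrightarrow> otw_length (h y) = otw_length y"
    using assms(2) unfolding otw_conjugate_def by blast
  have bij: "bij_betw h (otw_subshift X) (otw_subshift Y)"
    using homeomorphic_imp_injective_map[OF h] homeomorphic_imp_surjective_map[OF h]
    by (simp add: bij_betw_def topspace_otw_topology)
  define g where "g x = (THE y. h (Inf x) = Inf y)" for x
  have g: "h (Inf x) = Inf (g x)" "g x \<in> Y" if "x \<in> X" for x
  proof -
    have IX: "Inf x \<in> otw_subshift X" using that by (simp add: otw_subshift_def)
    obtain y where "h (Inf x) = Inf y" using len[OF IX] by (cases "h (Inf x)") auto
    then show "h (Inf x) = Inf (g x)" by (simp add: g_def)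
    then show "g x \<in> Y"
      using bij_betwE[OF bij] IX by (fastforce simp: otw_subshift_def)
  qed
  show thesis
  proof
    show "bij_betw g X Y"
    proof (rule bij_betwI')
      fix x y assume xy: "x \<in> X" "y \<in> X"
      then have "Inf x \<in> otw_subshift X" "Inf y \<in> otw_subshift X"
        by (auto simp: otw_subshift_def)
      then have "h (Inf x) = h (Inf y) \<longleftrightarrow> x = y"
        using inj_on_eq_iff[OF bij_betw_imp_inj_on[OF bij]] by simp
      then show "g x = g y \<longleftrightarrow> x = y" using g(1) xy by simp
    next
      fix y assume "y \<in> Y"
      then have "Inf y \<in> h ` otw_subshift X"
        using bij by (auto simp: bij_betw_def otw_subshift_def)
      then obtain z where z: "z \<in> otw_subshift X" "h z = Inf y" by auto
      then obtain x where "z = Inf x" "x \<in> X"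
        using len[OF z(1)] by (cases z) (auto simp: otw_subshift_def)
      then show "\<exists>x\<in>X. y = g x" using g(1) z(2) by auto
    qed (rule g(2))
    fix x assume x: "x \<in> X"
    then have "Inf x \<in> otw_subshift X" by (simp add: otw_subshift_def)
    from sh[OF this] show "g (shift x) = shift (g x)"
      using g(1)[OF x] g(1)[OF subshift_suffix[OF X x, of 1]] by simp
  next
    fix \<beta>
    define V where "V = {y \<in> otw_subshift X. h y \<in> otw_basic Y \<beta> {}}"
    have cont: "continuous_map (otw_topology X) (otw_topology Y) h"
      using h by (rule homeomorphic_imp_continuous_map)
    have V: "openin (otw_topology X) V" "closedin (otw_topology X) V"
      using openin_continuous_map_preimage[OF cont openin_otw_basic]
        closedin_continuous_map_preimage[OF cont closedin_otw_cylinder]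
      unfolding V_def topspace_otw_topology by auto
    have "length \<beta> \<le> length w" if "Fin w \<in> V" for w
      using that len[of "Fin w"] by (auto simp: V_def otw_basic_def begins_with_iff)
    from clopen_finite_union_gen_cyl[OF X V this]
    show "(finite union_of (\<lambda>B. \<exists>\<delta> G. finite G \<and> length \<beta> \<le> length \<delta> \<and> B = gen_cyl X \<delta> G))
        {x \<in> X. prefix (length \<beta>) (g x) = \<beta>}"
      by (rule back_subst[where P = "finite union_of _"])
        (use g in \<open>auto simp: V_def Inf_in_otw_basic otw_subshift_def gen_cyl_def\<close>)
  qed
qed

lemma commute_suffix:
  assumes "subshift X" and "\<And>x. x \<in> X \<Longrightarrow> g (shift x) = shift (g x)" and "x \<in> X"
  shows "g (suffix n x) = suffix n (g x)"
proof (induction n)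
  case (Suc n)
  have "g (shift (suffix n x)) = shift (g (suffix n x))"
    by (rule assms(2)[OF subshift_suffix[OF assms(1,3)]])
  then show ?case by (simp only: Suc suffix_suffix Suc_eq_plus1)
qed simp

text \<open>If \<open>g x\<close> lies in \<open>cyl Y \<alpha> \<beta>\<close>, the second point
  \<open>\<alpha> \<frown> suffix (length \<beta>) (g x)\<close> is \<open>g w\<close> for some
  \<open>w\<close>. Injectivity and commutation with the shift turn this into an equality of tails
  of \<open>w\<close> and \<open>x\<close>, and the lengths in \<open>cyls\<close> are those
  required by \<open>gen_cyl_transfer_in_boolean_alg\<close>.\<close>

lemma preimage_in_boolean_alg:
  assumes X: "subshift X" and Y: "subshift Y" and bij: "bij_betw g X Y"
    and sh: "\<And>x. x \<in> X \<Longrightarrow> g (shift x) = shift (g x)"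
    and cyls: "\<And>\<beta>. (finite union_of (\<lambda>B. \<exists>\<delta> G. finite G \<and> length \<beta> \<le> length \<delta>
        \<and> B = gen_cyl X \<delta> G)) {x \<in> X. prefix (length \<beta>) (g x) = \<beta>}"
    and A: "A \<in> boolean_alg Y"
  shows "{x \<in> X. g x \<in> A} \<in> boolean_alg X"
proof -
  interpret algebra X "boolean_alg X" by (rule algebra_boolean_alg)
  have gY: "g x \<in> Y" if "x \<in> X" for x using bij that by (auto simp: bij_betw_def)
  have cyl: "{x \<in> X. g x \<in> cyl Y \<alpha> \<beta>} \<in> boolean_alg X" for \<alpha> \<beta>
  proof -
    let ?P = "\<lambda>m B. \<exists>\<delta> G. finite G \<and> m \<le> length \<delta> \<and> B = gen_cyl X \<delta> G"
    obtain \<A> where \<A>: "finite \<A>" "\<A> \<subseteq> Collect (?P (length \<alpha>))"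
      "\<Union>\<A> = {x \<in> X. prefix (length \<alpha>) (g x) = \<alpha>}"
      using cyls[of \<alpha>] unfolding union_of_def by (elim exE conjE)
    obtain \<B> where \<B>: "finite \<B>" "\<B> \<subseteq> Collect (?P (length \<beta>))"
      "\<Union>\<B> = {x \<in> X. prefix (length \<beta>) (g x) = \<beta>}"
      using cyls[of \<beta>] unfolding union_of_def by (elim exE conjE)
    have "{x \<in> X. g x \<in> cyl Y \<alpha> \<beta>} =
        {x \<in> \<Union>\<B>. \<exists>w\<in>\<Union>\<A>. suffix (length \<alpha>) w = suffix (length \<beta>) x}" (is "?L = ?R")
    proof (intro equalityI subsetI)
      fix x assume "x \<in> ?L"
      then have x: "x \<in> X" "prefix (length \<beta>) (g x) = \<beta>" "\<alpha> \<frown> suffix (length \<beta>) (g x) \<in> Y"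
        by (auto simp: mem_cyl_iff)
      then obtain w where w: "w \<in> X" "g w = \<alpha> \<frown> suffix (length \<beta>) (g x)"
        using bij by (metis bij_betw_iff_bijections)
      then have "g (suffix (length \<alpha>) w) = g (suffix (length \<beta>) x)"
        using commute_suffix[of X g, OF X sh] x(1) by simp
      then have "suffix (length \<alpha>) w = suffix (length \<beta>) x"
        using bij subshift_suffix[OF X] x(1) w(1) unfolding bij_betw_def inj_on_def by blast
      then show "x \<in> ?R" unfolding \<A>(3) \<B>(3) using x w by auto
    next
      fix x assume "x \<in> ?R"
      then obtain w where x: "x \<in> X" "prefix (length \<beta>) (g x) = \<beta>"
        and w: "w \<in> X" "prefix (length \<alpha>) (g w) = \<alpha>"
          "suffix (length \<alpha>) w = suffix (length \<beta>) x"
        unfolding \<A>(3) \<B>(3) by blast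
      have "suffix (length \<alpha>) (g w) = suffix (length \<beta>) (g x)"
        using w(1,3) x(1) commute_suffix[of X g, OF X sh] by metis
      then have "\<alpha> \<frown> suffix (length \<beta>) (g x) = g w" using w(2) by (metis prefix_suffix)
      then show "x \<in> ?L" using x w(1) gY by (simp add: mem_cyl_iff)
    qed
    \<comment> \<open>The relation between \<open>x\<close> and \<open>w\<close> distributes over
      both unions, leaving finitely many pairs of generalized cylinders.\<close>
    also have "\<dots> = (\<Union>B\<in>\<B>. \<Union>A\<in>\<A>. {x \<in> B. \<exists>w\<in>A. suffix (length \<alpha>) w = suffix (length \<beta>) x})"
      by blast
    also have "\<dots> \<in> boolean_alg X"
    proof (intro finite_UN \<A>(1) \<B>(1))
      fix A B assume "A \<in> \<A>" "B \<in> \<B>"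
      then obtain \<gamma> F \<delta> G where "A = gen_cyl X \<gamma> F" "finite F" "length \<alpha> \<le> length \<gamma>"
        "B = gen_cyl X \<delta> G" "finite G" "length \<beta> \<le> length \<delta>"
        using \<A>(2) \<B>(2) by blast
      then show "{x \<in> B. \<exists>w\<in>A. suffix (length \<alpha>) w = suffix (length \<beta>) x} \<in> boolean_alg X"
        using gen_cyl_transfer_in_boolean_alg[OF X] by simp
    qed
    finally show ?thesis .
  qed
  \<comment> \<open>The sets with preimage in the algebra form an algebra containing the generators,
    hence they include the hull.\<close>
  let ?T = "{A. A \<subseteq> Y \<and> {x \<in> X. g x \<in> A} \<in> boolean_alg X}"
  have "boolean_alg Y \<subseteq> ?T" unfolding boolean_alg_def[of Y]
  proof (rule hull_minimal)
    show "{cyl Y \<alpha> \<beta> |\<alpha> \<beta>. \<alpha> \<in> language Y \<and> \<beta> \<in> language Y} \<subseteq> ?T"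
      using cyl by (auto simp: mem_cyl_iff)
    show "algebra Y ?T" unfolding algebra_iff_Un
    proof (intro conjI ballI)
      fix A assume A: "A \<in> ?T"
      have "{x \<in> X. g x \<in> Y - A} = X - {x \<in> X. g x \<in> A}" using gY by auto
      then show "Y - A \<in> ?T" using A by auto
      fix B assume B: "B \<in> ?T"
      have "{x \<in> X. g x \<in> A \<union> B} = {x \<in> X. g x \<in> A} \<union> {x \<in> X. g x \<in> B}" by auto
      then show "A \<union> B \<in> ?T" using A B by auto
    qed auto
  qed
  then show ?thesis using A by blast
qed


section \<open>Condition (Y)\<close>

text \<open>An equation between suffixes is the form of periodicity that an injective map commuting
  with the shift visibly preserves. Conversely, such an equation makes the block of length
  \<open>k\<close> at position \<open>m\<close> repeat forever.\<close>

lemma eventually_periodic_iff: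
  assumes "p \<in> X"
  shows "(\<exists>\<alpha>\<in>language X. \<exists>\<beta>\<in>language X. \<beta> \<noteq> [] \<and> p = \<alpha> \<frown> \<beta>\<^sup>\<omega>) \<longleftrightarrow>
    (\<exists>m k. k > 0 \<and> suffix (m + k) p = suffix m p)"
proof
  assume "\<exists>\<alpha>\<in>language X. \<exists>\<beta>\<in>language X. \<beta> \<noteq> [] \<and> p = \<alpha> \<frown> \<beta>\<^sup>\<omega>"
  then obtain \<alpha> \<beta> where p: "\<beta> \<noteq> []" "p = \<alpha> \<frown> \<beta>\<^sup>\<omega>" by blast
  then have "suffix (length \<beta>) (\<beta>\<^sup>\<omega>) = \<beta>\<^sup>\<omega>" by (simp add: fun_eq_iff)
  then have "suffix (length \<alpha> + length \<beta>) p = suffix (length \<alpha>) p"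
    using p(2) by (metis suffix_suffix suffix_conc_length)
  then show "\<exists>m k. k > 0 \<and> suffix (m + k) p = suffix m p" using p(1) by blast
next
  assume "\<exists>m k. k > 0 \<and> suffix (m + k) p = suffix m p"
  then obtain m k where k: "k > 0" and per: "suffix (m + k) p = suffix m p" by blast
  let ?q = "suffix m p" and ?\<beta> = "p [m \<rightarrow> m + k]"
  have q: "?q (i + k * j) = ?q i" for i j
  proof (induction j)
    case (Suc j)
    have "?q (i + k * Suc j) = suffix (m + k) p (i + k * j)" by (simp add: algebra_simps)
    then show ?case using per Suc by simp
  qed simp
  have "?q n = ?\<beta>\<^sup>\<omega> n" for n
    using q[of "n mod k" "n div k"] k by simp
  then have "p = prefix m p \<frown> ?\<beta>\<^sup>\<omega>" by (metis ext prefix_suffix)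
  moreover have "?\<beta> \<noteq> []" using k by simp
  moreover have "?\<beta> \<in> language X" using assms by (auto simp: language_def occurs_in_def)
  ultimately show "\<exists>\<alpha>\<in>language X. \<exists>\<beta>\<in>language X. \<beta> \<noteq> [] \<and> p = \<alpha> \<frown> \<beta>\<^sup>\<omega>"
    using prefix_in_language[OF assms] by blast
qed

lemma Q_set_iff:
  "p \<in> Q_set X \<longleftrightarrow> p \<in> X \<and> {p} \<in> boolean_alg X \<and> (\<forall>m k. k > 0 \<longrightarrow> suffix (m + k) p \<noteq> suffix m p)"
proof -
  have "p \<in> X" if "{p} \<in> boolean_alg X"
    using algebra_boolean_alg[of X] that by (auto simp: algebra_iff_Un)
  then show ?thesis using eventually_periodic_iff[of p X] by (auto simp: Q_set_def)
qed

text \<open>Removing earlier levels only records each point at the first level reaching it; the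
  union is still everything whose forward orbit meets that of \<open>p\<close>.\<close>

lemma J_set_eq:
  assumes X: "subshift X" and p: "p \<in> X"
  shows "J_set X p = {x \<in> X. tail_equiv x p}"
proof (intro equalityI subsetI)
  have "x \<in> X \<and> tail_equiv x p" if "x \<in> J_level X p n" for x n
    using that
  proof (induction n arbitrary: x)
    case 0
    then obtain n where n: "x = suffix n p" by auto
    then have "suffix 0 x = suffix n p" by simp
    then show ?case using subshift_suffix[OF X p] n unfolding tail_equiv_def by blast
  next
    case (Suc n)
    then have "x \<in> X" "tail_equiv (shift x) p" by auto
    then show ?case by (auto simp: tail_equiv_def)
  qed
  then show "x \<in> {x \<in> X. tail_equiv x p}" if "x \<in> J_set X p" for x
    using that by (auto simp: J_set_def)
next
  fix x assume "x \<in> {x \<in> X. tail_equiv x p}"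
  then obtain m n where "x \<in> X" "suffix m x = suffix n p" by (auto simp: tail_equiv_def)
  then show "x \<in> J_set X p"
  proof (induction m arbitrary: x)
    case 0
    then have "x \<in> J_level X p 0" by (auto simp del: suffix_nth)
    then show ?case unfolding J_set_def by blast
  next
    case (Suc m)
    have "suffix m (shift x) = suffix n p"
      using Suc.prems(2) by (simp only: suffix_suffix Suc_eq_plus1_left)
    then have "shift x \<in> J_set X p" by (rule Suc.IH[OF subshift_suffix[OF X Suc.prems(1)]])
    then obtain k where "shift x \<in> J_level X p k" by (auto simp: J_set_def)
    \<comment> \<open>The subtraction rejects \<open>x\<close> only if a level up to
      \<open>k\<close> already contains it.\<close>
    then have "x \<in> J_level X p (Suc k) \<or> (\<exists>j\<le>k. x \<in> J_level X p j)"
      using Suc.prems(1) by auto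
    then show ?case unfolding J_set_def by blast
  qed
qed

section \<open>Paths in the associated graph\<close>

lemma associated_graph_simps [simp]:
  "verts (associated_graph X R) = (SIGMA r:R. J_set X r)"
  "arcs (associated_graph X R) = (SIGMA r:R. J_set X r)"
  "tail (associated_graph X R) (r, z) = (r, z)"
  "head (associated_graph X R) (r, z) = (r, shift z)"
  by (auto simp: associated_graph_def disjoint_union_graph_def orbit_graph_def)

text \<open>The only edge leaving \<open>(r, z)\<close> leads to \<open>(r, shift z)\<close>, so the
  first edge determines the path, which stays in one component.\<close>

lemma infinite_path_associated_graph:
  "infinite_path (associated_graph X R) e \<longleftrightarrow>
     (\<exists>r\<in>R. \<exists>z\<in>J_set X r. \<forall>i. e i = (r, suffix i z))" (is "?L \<longleftrightarrow> ?R")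
proof
  assume L: ?L
  obtain r z where e0: "e 0 = (r, z)" by fastforce
  have "r \<in> R" "z \<in> J_set X r" using L e0 unfolding infinite_path_def by (auto dest: spec[of _ 0])
  moreover have "e i = (r, suffix i z)" for i
  proof (induction i)
    case (Suc i)
    obtain s y where e: "e (Suc i) = (s, y)" by fastforce
    have "head (associated_graph X R) (e i) = tail (associated_graph X R) (e (Suc i))"
      using L by (simp add: infinite_path_def)
    then have "e (Suc i) = (r, shift (suffix i z))" by (simp only: e Suc associated_graph_simps)
    then show ?case by (simp only: suffix_suffix Suc_eq_plus1)
  qed (simp add: e0)
  ultimately show ?R by blast
next
  assume ?R
  then obtain r z where "r \<in> R" "z \<in> J_set X r" and e: "\<And>i. e i = (r, suffix i z)" by blast
  have "suffix i z \<in> J_set X r" for i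
  proof (induction i)
    case (Suc i)
    from shift_J_set[OF this] show ?case by (simp only: suffix_suffix Suc_eq_plus1)
  qed (simp add: \<open>z \<in> _\<close>)
  then show ?L using \<open>r \<in> R\<close> by (simp add: infinite_path_def e)
qed

text \<open>A finite walk is likewise forced by its start: each edge applies the shift once.\<close>

lemma awalk_associated_graph:
  "(\<exists>u \<alpha>. pre_digraph.awalk (associated_graph X R) u \<alpha> (r, z) \<and> length \<alpha> = n) \<longleftrightarrow>
     r \<in> R \<and> (\<exists>y\<in>J_set X r. suffix n y = z)" (is "?L \<longleftrightarrow> ?R")
proof
  interpret wf_digraph "associated_graph X R" by (rule wf_associated_graph)
  have "\<exists>y. u = (r, y) \<and> r \<in> R \<and> y \<in> J_set X r \<and> suffix (length \<alpha>) y = z"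
    if "awalk u \<alpha> (r, z)" for u \<alpha>
    using that
  proof (induction \<alpha> arbitrary: u)
    case (Cons a \<alpha>)
    obtain s y where a: "a = (s, y)" by fastforce
    then have y: "s \<in> R" "y \<in> J_set X s" "u = (s, y)" and "awalk (s, shift y) \<alpha> (r, z)"
      using Cons.prems by (simp_all add: awalk_Cons_iff)
    then have "s = r" "suffix (length \<alpha>) (shift y) = z" using Cons.IH by blast+
    then show ?case using y by (intro exI[of _ y]) simp
  qed (auto simp: awalk_Nil_iff)
  then show "?L \<Longrightarrow> ?R" by blast
next
  interpret wf_digraph "associated_graph X R" by (rule wf_associated_graph)
  have "\<exists>\<alpha>. awalk (r, y) \<alpha> (r, suffix n y) \<and> length \<alpha> = n" if "r \<in> R" "y \<in> J_set X r" for y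
    using that
  proof (induction n arbitrary: y)
    case (Suc n)
    then obtain \<alpha> where "awalk (r, shift y) \<alpha> (r, suffix n (shift y))" "length \<alpha> = n"
      using shift_J_set by blast
    then show ?case using Suc.prems by (intro exI[of _ "(r, y) # \<alpha>"]) (simp add: awalk_Cons_iff del: suffix_nth)
  qed (simp add: awalk_Nil_iff)
  then show "?R \<Longrightarrow> ?L" by blast
qed

lemma representatives_obtain:
  assumes "representatives X R" and "p \<in> Q_set X"
  obtains r where "r \<in> R" and "tail_equiv p r"
proof -
  have "Q_rel X `` {p} \<in> Q_set X // Q_rel X" using assms(2) by (rule quotientI)
  then obtain r where "r \<in> R \<inter> Q_rel X `` {p}" using assms(1) unfolding representatives_def by blast
  then show thesis using that by (auto simp: Q_rel_def)
qed

text \<open>The right-hand side is free of representatives and graphs, so it can be transported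
  pointwise between subshifts.\<close>

lemma condition_Y_iff:
  assumes X: "subshift X" and R: "representatives X R"
  shows "condition_Y (associated_graph X R) \<longleftrightarrow>
    (\<forall>z\<in>X. \<forall>p\<in>Q_set X. tail_equiv z p \<longrightarrow> (\<exists>k. \<exists>y\<in>X. suffix (Suc k) y = suffix k z))"
    (is "_ \<longleftrightarrow> ?R")
proof -
  have RQ: "r \<in> Q_set X" "r \<in> X" if "r \<in> R" for r
    using R that by (auto simp: representatives_def Q_set_iff)
  have J: "J_set X r = {x \<in> X. tail_equiv x r}" if "r \<in> R" for r
    by (rule J_set_eq[OF X RQ(2)[OF that]])
  \<comment> \<open>The path from \<open>z\<close> has \<open>suffix k z\<close> as the source of
    its edge with index \<open>k\<close>, and a walk of \<open>k + 1\<close> edges ending there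
    starts at the required \<open>y\<close>.\<close>
  have "condition_Y (associated_graph X R) \<longleftrightarrow>
      (\<forall>r\<in>R. \<forall>z\<in>J_set X r. \<exists>k. \<exists>y\<in>J_set X r. suffix (Suc k) y = suffix k z)" (is "_ \<longleftrightarrow> ?M")
  proof
    assume Y: "condition_Y (associated_graph X R)"
    show ?M
    proof (intro ballI)
      fix r z assume rz: "r \<in> R" "z \<in> J_set X r"
      then have "infinite_path (associated_graph X R) (\<lambda>i. (r, suffix i z))"
        unfolding infinite_path_associated_graph by blast
      then obtain k where "\<exists>u \<alpha>. pre_digraph.awalk (associated_graph X R) u \<alpha> (r, suffix k z)
          \<and> length \<alpha> = Suc k"
        using Y unfolding condition_Y_def by fastforce
      then show "\<exists>k. \<exists>y\<in>J_set X r. suffix (Suc k) y = suffix k z"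
        unfolding awalk_associated_graph by blast
    qed
  next
    assume M: ?M
    show "condition_Y (associated_graph X R)" unfolding condition_Y_def
    proof (intro allI impI)
      fix e assume "infinite_path (associated_graph X R) e"
      then obtain r z where rz: "r \<in> R" "z \<in> J_set X r" and e: "\<And>i. e i = (r, suffix i z)"
        unfolding infinite_path_associated_graph by blast
      obtain k where "\<exists>y\<in>J_set X r. suffix (Suc k) y = suffix k z" using M rz by blast
      then have "\<exists>u \<alpha>. pre_digraph.awalk (associated_graph X R) u \<alpha> (r, suffix k z)
          \<and> length \<alpha> = Suc k"
        unfolding awalk_associated_graph using rz(1) by blast
      then show "\<exists>k u \<alpha>. pre_digraph.awalk (associated_graph X R) u \<alpha>
          (tail (associated_graph X R) (e k)) \<and> length \<alpha> = k + 1"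
        by (auto simp: e)
    qed
  qed
  also have "\<dots> \<longleftrightarrow> ?R"
  proof
    assume M: ?M
    show ?R
    proof (intro ballI impI)
      fix z p assume "z \<in> X" "p \<in> Q_set X" "tail_equiv z p"
      moreover obtain r where r: "r \<in> R" "tail_equiv p r"
        using representatives_obtain[OF R \<open>p \<in> Q_set X\<close>] .
      ultimately have "z \<in> J_set X r" using J[OF r(1)] tail_equiv_trans by blast
      then show "\<exists>k. \<exists>y\<in>X. suffix (Suc k) y = suffix k z" using M r(1) J by blast
    qed
  next
    assume N: ?R
    show ?M
    proof (intro ballI)
      fix r z assume r: "r \<in> R" and "z \<in> J_set X r"
      then have z: "z \<in> X" "tail_equiv z r" using J by auto
      then obtain k y where y: "y \<in> X" "suffix (Suc k) y = suffix k z" using N RQ(1)[OF r] by blast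
      \<comment> \<open>Sharing a tail with \<open>z\<close> puts \<open>y\<close> into the same
        component automatically.\<close>
      have "tail_equiv y z" unfolding tail_equiv_def using y(2) by blast
      then have "y \<in> J_set X r" using J[OF r] y(1) z(2) tail_equiv_trans by blast
      then show "\<exists>k. \<exists>y\<in>J_set X r. suffix (Suc k) y = suffix k z" using y(2) by blast
    qed
  qed
  finally show ?thesis .
qed

section \<open>Transport of Condition (Y) along a conjugacy\<close>

theorem theorem5p14:
  fixes X1 R1 :: "'a word set" and X2 R2 :: "'b word set"
  assumes "subshift X1" and "subshift X2"
    and "representatives X1 R1" and "representatives X2 R2"
    and "condition_Y (associated_graph X1 R1)"
    and "\<not> condition_Y (associated_graph X2 R2)"
  shows "\<not> otw_conjugate X1 X2"
proof
  assume "otw_conjugate X1 X2"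
  then obtain g where bij: "bij_betw g X1 X2"
    and sh: "\<And>x. x \<in> X1 \<Longrightarrow> g (shift x) = shift (g x)"
    and cyls: "\<And>\<beta>. (finite union_of (\<lambda>B. \<exists>\<delta> G. finite G \<and> length \<beta> \<le> length \<delta>
        \<and> B = gen_cyl X1 \<delta> G)) {x \<in> X1. prefix (length \<beta>) (g x) = \<beta>}"
    using otw_conjugate_on_words[OF assms(1)] by blast
  have suf: "g (suffix n x) = suffix n (g x)" if "x \<in> X1" for n x
    using commute_suffix[of X1 g, OF assms(1) sh that] .
  have inj: "x = y" if "x \<in> X1" "y \<in> X1" "g x = g y" for x y
    using bij that by (auto simp: bij_betw_def inj_on_def)
  have sufX: "suffix n x \<in> X1" if "x \<in> X1" for n x
    using subshift_suffix[OF assms(1) that] .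
  \<comment> \<open>Tail equivalence, eventual periodicity and the reformulated Condition (Y) are
    all built from equations of this shape.\<close>
  have suf_eq: "suffix m x = suffix n y \<longleftrightarrow> suffix m (g x) = suffix n (g y)"
    if "x \<in> X1" "y \<in> X1" for m n x y
    using inj[OF sufX sufX, OF that, of m n] suf that by metis
  \<comment> \<open>By injectivity \<open>{p}\<close> is the preimage of \<open>{g p}\<close>. The
    pull-back goes from \<open>X2\<close> to \<open>X1\<close> because Condition (Y) is available
    there.\<close>
  have Q: "p \<in> Q_set X1" if "p \<in> X1" "g p \<in> Q_set X2" for p
  proof -
    have "{x \<in> X1. g x \<in> {g p}} \<in> boolean_alg X1"
      using that(2) by (intro preimage_in_boolean_alg[OF assms(1,2) bij sh cyls])
        (auto simp: Q_set_iff)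
    moreover have "{x \<in> X1. g x \<in> {g p}} = {p}" using inj that(1) by auto
    ultimately show ?thesis
      using that suf_eq[OF that(1) that(1)] by (simp add: Q_set_iff)
  qed
  have "condition_Y (associated_graph X2 R2)"
    unfolding condition_Y_iff[OF assms(2,4)]
  proof (intro ballI impI)
    fix z q assume z: "z \<in> X2" and q: "q \<in> Q_set X2" and zq: "tail_equiv z q"
    obtain z' where z': "z' \<in> X1" "g z' = z" using bij z by (auto simp: bij_betw_def)
    obtain p where p: "p \<in> X1" "g p = q" using bij q by (auto simp: bij_betw_def Q_set_iff)
    have "tail_equiv z' p"
      using zq suf_eq[OF z'(1) p(1)] z'(2) p(2) by (simp add: tail_equiv_def)
    then obtain k y where "y \<in> X1" "suffix (Suc k) y = suffix k z'"
      using assms(5) Q p q z'(1) unfolding condition_Y_iff[OF assms(1,3)] by blast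
    then have "suffix (Suc k) (g y) = suffix k z" "g y \<in> X2"
      using suf_eq z' bij by (auto simp: bij_betw_def)
    then show "\<exists>k. \<exists>y\<in>X2. suffix (Suc k) y = suffix k z" by blast
  qed
  then show False using assms(6) by contradiction
qed

end
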